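(* Let $X$ be an infinite countable set, $\lambda=\{\lambda_n\}_{n\in\mathbb N}$ a sequence of probability measures on $X$, and $(X,P)$ a reversible random walk with reversibility measure $m$ satisfying $\inf_{x\in X} m(x)>0$ and $\sup_{x\in X}m(x)<+\infty$. Then the following are equivalent: (a) the random walk is $\lambda$-TOA; (b) there exists $A\subseteq X$ such that $\mathrm{sup}L_\lambda(A)>0$, for every $x\in A$ there is a finite energy flow $u^x$ from $x$ to $\infty$ with non-zero input $i_0$ (the same $i_0$ for all $x\in A$), and $\sup_{x\in A}\langle u^x,u^x\rangle<+\infty$; (c) there exists $A\subseteq X$ such that $\mathrm{sup}L_\lambda(A)>0$ and $\inf_{x\in A}\mathrm{cap}(x)>0$.
   Context: A random walk $(X,P)$ is a Markov chain on $X$ with stochastic transition matrix $P=(p(x,y))$. It is reversible with reversibility measure $m:X\to(0,\infty)$ if $m(x)p(x,y)=m(y)p(y,x)$ for all $x,y$. $F(x,x)=\sum_{n\ge1}f^{(n)}(x,x)$, where $f^{(n)}(x,x)$ is the probability that the walk started at $x$ returns to $x$ for the first time at time $n$. $(X,P)$ is $\lambda$-TOA (transient on the average with respect to $\lambda$) if $\liminf_{n\to\infty}\sum_{x\in X}F(x,x)\lambda_n(x)<1$. For $A\subseteq X$, $\mathrm{sup}L_\lambda(A)=\limsup_{n\to\infty}\lambda_n(A)$. Associated electric network: $E(X)$ is the set of edges $\{x,y\}$ with $p(x,y)>0$; each edge $e$ is given one (arbitrary) orientation $e=(e^-,e^+)$ and the resistance $r(e)=(m(e^-)p(e^-,e^+))^{-1}$.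 A flow from $x$ to $\infty$ with input $i_0$ is a function $u:E(X)\to\mathbb R$ with $$\sum_{e:e^-=y}u(e)=\sum_{e:e^+=y}u(e)+i_0\,\delta_x(y)\qquad\forall y\in X;$$ its energy is $\langle u,u\rangle=\sum_{e\in E(X)}u(e)^2r(e)$. The capacity of $x$ is $\mathrm{cap}(x)=\inf\sum_{e\in E(X)}(f(e^+)-f(e^-))^2/r(e)$, the infimum being over finitely supported $f:X\to\mathbb R$ with $f(x)=1$. *)

theory Defs
  imports "HOL-Probability.Probability"
begin

text \<open>
  A stochastic matrix on the (countable) type \<open>'a\<close> is represented by its rows,
  \<open>K :: 'a \<Rightarrow> 'a pmf\<close>, with entries \<open>p(x,y) = pmf (K x) y\<close>.
  Sums of nonnegative terms are taken in \<^typ>\<open>ennreal\<close>, so they always exist.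
\<close>

definition reversible :: "('a \<Rightarrow> 'a pmf) \<Rightarrow> ('a \<Rightarrow> real) \<Rightarrow> bool" where
  "reversible K m \<longleftrightarrow>
     (\<forall>x. m x > 0) \<and> (\<forall>x y. m x * pmf (K x) y = m y * pmf (K y) x)"

text \<open>The law of the trajectory \<open>[X\<^sub>0, \<dots>, X\<^sub>n]\<close> of the walk started at \<open>X\<^sub>0 = x\<close>.\<close>

primrec trajectory :: "('a \<Rightarrow> 'a pmf) \<Rightarrow> 'a \<Rightarrow> nat \<Rightarrow> 'a list pmf" where
  "trajectory K x 0 = return_pmf [x]"
| "trajectory K x (Suc n) = map_pmf (Cons x) (bind_pmf (K x) (\<lambda>y. trajectory K y n))"

definition first_return :: "('a \<Rightarrow> 'a pmf) \<Rightarrow> nat \<Rightarrow> 'a \<Rightarrow> ennreal" where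
  "first_return K n x =
     emeasure (trajectory K x n) {w. w ! n = x \<and> (\<forall>k\<in>{1..<n}. w ! k \<noteq> x)}"

definition return_prob :: "('a \<Rightarrow> 'a pmf) \<Rightarrow> 'a \<Rightarrow> ennreal" where
  "return_prob K x = (\<Sum>\<^sub>\<infinity>n\<in>{1..}. first_return K n x)"

definition TOA :: "(nat \<Rightarrow> 'a pmf) \<Rightarrow> ('a \<Rightarrow> 'a pmf) \<Rightarrow> bool" where
  "TOA lam K \<longleftrightarrow>
     liminf (\<lambda>n. \<Sum>\<^sub>\<infinity>x. return_prob K x * ennreal (pmf (lam n) x)) < 1"

definition supL :: "(nat \<Rightarrow> 'a pmf) \<Rightarrow> 'a set \<Rightarrow> ennreal" where
  "supL lam A = limsup (\<lambda>n. emeasure (lam n) A)"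

text \<open>Edges are unordered pairs; a loop at \<open>x\<close> is the singleton \<open>{x}\<close>.\<close>

definition edges :: "('a \<Rightarrow> 'a pmf) \<Rightarrow> 'a set set" where
  "edges K = {{x, y} | x y. pmf (K x) y > 0}"

text \<open>
  An orientation is given by the maps \<open>src e = e\<^sup>-\<close> and \<open>tgt e = e\<^sup>+\<close>.
\<close>

definition orientation :: "('a \<Rightarrow> 'a pmf) \<Rightarrow> ('a set \<Rightarrow> 'a) \<Rightarrow> ('a set \<Rightarrow> 'a) \<Rightarrow> bool" where
  "orientation K src tgt \<longleftrightarrow> (\<forall>e\<in>edges K. e = {src e, tgt e})"

definition resistance ::
    "('a \<Rightarrow> 'a pmf) \<Rightarrow> ('a \<Rightarrow> real) \<Rightarrow> ('a set \<Rightarrow> 'a) \<Rightarrow> ('a set \<Rightarrow> 'a) \<Rightarrow> 'a set \<Rightarrow> real" where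
  "resistance K m src tgt e = inverse (m (src e) * pmf (K (src e)) (tgt e))"

text \<open>
  The graph need not be locally finite, so the sums in the node law may be infinite;
  their (absolute) convergence is part of the definition of a flow. It is automatic for
  flows of finite energy, since the conductances at \<open>y\<close> add up to at most \<open>m y\<close>.
\<close>

definition flow_to_infinity ::
    "('a \<Rightarrow> 'a pmf) \<Rightarrow> ('a set \<Rightarrow> 'a) \<Rightarrow> ('a set \<Rightarrow> 'a) \<Rightarrow> 'a \<Rightarrow> real \<Rightarrow> ('a set \<Rightarrow> real) \<Rightarrow> bool" where
  "flow_to_infinity K src tgt x i0 u \<longleftrightarrow>
     (\<forall>y. u summable_on {e \<in> edges K. src e = y} \<and>
          u summable_on {e \<in> edges K. tgt e = y} \<and>
          (\<Sum>\<^sub>\<infinity>e\<in>{e \<in> edges K. src e = y}. u e) =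
            (\<Sum>\<^sub>\<infinity>e\<in>{e \<in> edges K. tgt e = y}. u e) + i0 * (if y = x then 1 else 0))"

definition energy ::
    "('a \<Rightarrow> 'a pmf) \<Rightarrow> ('a \<Rightarrow> real) \<Rightarrow> ('a set \<Rightarrow> 'a) \<Rightarrow> ('a set \<Rightarrow> 'a) \<Rightarrow> ('a set \<Rightarrow> real) \<Rightarrow> ennreal" where
  "energy K m src tgt u =
     (\<Sum>\<^sub>\<infinity>e\<in>edges K. ennreal ((u e)\<^sup>2 * resistance K m src tgt e))"

definition capacity ::
    "('a \<Rightarrow> 'a pmf) \<Rightarrow> ('a \<Rightarrow> real) \<Rightarrow> ('a set \<Rightarrow> 'a) \<Rightarrow> ('a set \<Rightarrow> 'a) \<Rightarrow> 'a \<Rightarrow> ennreal" where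
  "capacity K m src tgt x =
     (INF f\<in>{f :: 'a \<Rightarrow> real. finite {y. f y \<noteq> 0} \<and> f x = 1}.
        \<Sum>\<^sub>\<infinity>e\<in>edges K. ennreal ((f (tgt e) - f (src e))\<^sup>2 / resistance K m src tgt e))"

end

theory Submission
  imports Defs
begin

text \<open>
  The link between the three conditions is the identity \<open>cap(x) = m(x) (1 - F(x,x))\<close>, of which
  only the inequality \<open>\<le>\<close> is needed directly. Let \<open>f\<^sub>n(y)\<close> be the probability of reaching \<open>x\<close> from
  \<open>y\<close> within \<open>n\<close> steps for the walk killed outside a growing finite set. These functions are
  finitely supported and increase to the hitting probability \<open>h\<close>, so they are subharmonic off
  \<open>x\<close>, and Green's formula bounds their Dirichlet energy by \<open>m(x) (1 - P f\<^sub>n(x))\<close>, which tends to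
  \<open>m(x) (1 - F(x,x))\<close>. Hence the bound on the capacity. By Fatou it also bounds the energy of
  \<open>h\<close>, so the gradient of \<open>h\<close>, divided by \<open>m(x) (1 - F(x,x))\<close>, is a unit flow of energy at
  most \<open>1 / (m(x) (1 - F(x,x)))\<close>. Conversely, pairing a flow of input \<open>i\<^sub>0\<close> with a test function
  gives \<open>i\<^sub>0\<^sup>2 \<le> \<langle>u,u\<rangle> cap(x)\<close> by Cauchy-Schwarz. Finally, a mean of \<open>F \<le> 1\<close> stays away from 1
  along a subsequence iff sets \<open>{F \<le> d}\<close> with \<open>d < 1\<close> keep positive mass along it.
\<close>

section \<open>Averages of functions bounded by one\<close>

text \<open>An enumeration of an infinite \<open>A\<close> turns both sides into the same series.
  This links the sums in the definitions to integrals, where monotone convergence is at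
  hand.\<close>

lemma nn_integral_count_space_eq_infsum:
  fixes f :: "'a \<Rightarrow> ennreal"
  assumes "countable A"
  shows "(\<integral>\<^sup>+x. f x \<partial>count_space A) = (\<Sum>\<^sub>\<infinity>x\<in>A. f x)"
proof (cases "finite A")
  case True
  then show ?thesis
    by (simp add: nn_integral_count_space_finite)
next
  case False
  define g where "g = from_nat_into A"
  have g: "bij_betw g UNIV A"
    using bij_betw_from_nat_into[OF assms False] by (simp add: g_def)
  have "(\<integral>\<^sup>+x. f x \<partial>count_space A) = (\<Sum>n. f (g n))"
    by (simp add: nn_integral_count_space_nat flip: nn_integral_bij_count_space[OF g])
  also have "\<dots> = (\<Sum>\<^sub>\<infinity>n. f (g n))"
    by (intro sums_unique[symmetric] has_sum_imp_sums has_sum_infsum nonneg_summable_on_complete) simp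
  also have "\<dots> = (\<Sum>\<^sub>\<infinity>x\<in>A. f x)"
    by (rule infsum_reindex_bij_betw[OF g])
  finally show ?thesis .
qed

lemma integrable_measure_pmf_bounded:
  fixes f :: "'a \<Rightarrow> real"
  assumes "\<And>z. \<bar>f z\<bar> \<le> C"
  shows "integrable (measure_pmf p) f"
  by (rule measure_pmf.integrable_const_bound[where B = C]) (use assms in auto)

text \<open>The pmf is a density with respect to counting measure, so boundedness of
  \<open>f\<close> gives absolute summability. Sums over the neighbours of a vertex are evaluated in
  this form.\<close>

lemma has_sum_expectation:
  fixes f :: "'a \<Rightarrow> real"
  assumes "\<And>z. \<bar>f z\<bar> \<le> C"
  shows "((\<lambda>z. pmf p z * f z) has_sum measure_pmf.expectation p f) UNIV"
proof -
  have "integrable (count_space UNIV) (\<lambda>z. pmf p z * f z)"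
    using integrable_measure_pmf_bounded[of f C p, OF assms]
    by (simp add: measure_pmf_eq_density integrable_density)
  then have *: "Infinite_Set_Sum.abs_summable_on (\<lambda>z. pmf p z * f z) UNIV"
    by (simp add: Infinite_Set_Sum.abs_summable_on_def)
  from abs_summable_summable[OF iffD2[OF abs_summable_equivalent this]]
  have "((\<lambda>z. pmf p z * f z) has_sum infsum (\<lambda>z. pmf p z * f z) UNIV) UNIV"
    by (rule has_sum_infsum)
  also have "infsum (\<lambda>z. pmf p z * f z) UNIV = infsetsum (\<lambda>z. pmf p z * f z) UNIV"
    by (rule infsetsum_infsum[OF *, symmetric])
  also have "\<dots> = measure_pmf.expectation p f"
    by (simp add: measure_pmf_eq_density integral_density infsetsum_def)
  finally show ?thesis .
qed

lemma nn_integral_pmf_eq_expectation: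
  assumes "\<And>z. 0 \<le> f z" "\<And>z. f z \<le> (C :: real)"
  shows "(\<integral>\<^sup>+z. ennreal (f z) \<partial>measure_pmf p) = ennreal (measure_pmf.expectation p f)"
proof (rule nn_integral_eq_integral)
  show "integrable (measure_pmf p) f"
    by (rule integrable_measure_pmf_bounded[where C = C]) (use assms in simp)
qed (use assms in simp)

lemma expectation_pmf_mono:
  assumes "\<And>z. 0 \<le> f z" "\<And>z. f z \<le> g z" "\<And>z. g z \<le> (C :: real)"
  shows "measure_pmf.expectation p f \<le> measure_pmf.expectation p g"
proof (rule integral_mono)
  have "\<bar>f z\<bar> \<le> C" "\<bar>g z\<bar> \<le> C" for z
    using assms[of z] by auto
  then show "integrable (measure_pmf p) f" "integrable (measure_pmf p) g"
    by (auto intro: integrable_measure_pmf_bounded)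
qed (use assms in auto)

lemma expectation_pmf_unit_interval:
  assumes "\<And>z. 0 \<le> f z" "\<And>z. f z \<le> (1 :: real)"
  shows "0 \<le> measure_pmf.expectation p f" "measure_pmf.expectation p f \<le> 1"
  using expectation_pmf_mono[of "\<lambda>_. 0" f 1 p] expectation_pmf_mono[of f "\<lambda>_. 1" 1 p] assms
  by auto

section \<open>Averages along a sequence of measures\<close>

lemma liminf_less_one_iff:
  fixes X :: "nat \<Rightarrow> real"
  assumes "\<And>n. 0 \<le> X n"
  shows "liminf (\<lambda>n. ennreal (X n)) < 1 \<longleftrightarrow> (\<exists>c<1. \<exists>\<^sub>F n in sequentially. X n \<le> c)"
proof
  assume "liminf (\<lambda>n. ennreal (X n)) < 1"
  then obtain y where y: "y < 1" "\<not> (\<forall>\<^sub>F n in sequentially. y < ennreal (X n))"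
    by (auto simp: not_le[symmetric] le_Liminf_iff)
  then have "\<exists>\<^sub>F n in sequentially. ennreal (X n) \<le> y"
    by (simp add: frequently_def not_le)
  moreover have "X n \<le> enn2real y" if "ennreal (X n) \<le> y" for n
    using enn2real_mono[OF that] y(1) assms[of n] by (simp add: order_less_trans)
  moreover have "enn2real y < 1"
    using y(1) by (cases y) (auto simp: ennreal_less_one_iff)
  ultimately show "\<exists>c<1. \<exists>\<^sub>F n in sequentially. X n \<le> c"
    by (auto elim!: frequently_elim1)
next
  assume "\<exists>c<1. \<exists>\<^sub>F n in sequentially. X n \<le> c"
  then obtain c where c: "c < 1" "\<exists>\<^sub>F n in sequentially. X n \<le> c"
    by blast
  then have "\<exists>\<^sub>F n in sequentially. ennreal (X n) \<le> ennreal c"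
    by (auto elim!: frequently_elim1 intro: ennreal_leI)
  then have "\<not> (\<forall>\<^sub>F n in sequentially. ennreal c < ennreal (X n))"
    by (simp add: frequently_def not_le)
  moreover have "ennreal c < 1"
    using c(1) by (simp add: ennreal_less_one_iff)
  ultimately show "liminf (\<lambda>n. ennreal (X n)) < 1"
    unfolding not_le[symmetric] le_Liminf_iff by blast
qed

lemma limsup_positive_iff:
  fixes X :: "nat \<Rightarrow> real"
  shows "limsup (\<lambda>n. ennreal (X n)) > 0 \<longleftrightarrow> (\<exists>c>0. \<exists>\<^sub>F n in sequentially. c \<le> X n)"
proof
  assume "limsup (\<lambda>n. ennreal (X n)) > 0"
  then obtain y where y: "y > 0" "\<not> (\<forall>\<^sub>F n in sequentially. ennreal (X n) < y)"
    using Limsup_le_iff[of sequentially "\<lambda>n. ennreal (X n)" 0] by (auto simp: not_le[symmetric])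
  then have *: "\<exists>\<^sub>F n in sequentially. y \<le> ennreal (X n)"
    by (simp add: frequently_def not_le)
  \<comment> \<open>The level \<open>y\<close> could be infinite a priori; lying below some real
    \<open>X n\<close> rules this out.\<close>
  then have "y < \<infinity>"
    by (metis (no_types, lifting) frequently_ex ennreal_less_top infinity_ennreal_def le_less_trans)
  then obtain c where c: "y = ennreal c" "c > 0"
    using y(1) by (cases y) auto
  moreover have "\<exists>\<^sub>F n in sequentially. c \<le> X n"
    using * by (rule frequently_elim1) (use c in \<open>auto simp: ennreal_le_iff2\<close>)
  ultimately show "\<exists>c>0. \<exists>\<^sub>F n in sequentially. c \<le> X n"
    by blast
next
  assume "\<exists>c>0. \<exists>\<^sub>F n in sequentially. c \<le> X n"
  then obtain c where c: "c > 0" "\<exists>\<^sub>F n in sequentially. c \<le> X n"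
    by blast
  then have "\<exists>\<^sub>F n in sequentially. ennreal c \<le> ennreal (X n)"
    by (auto elim!: frequently_elim1 intro: ennreal_leI)
  then have "\<not> (\<forall>\<^sub>F n in sequentially. ennreal (X n) < ennreal c)"
    by (simp add: frequently_def not_le)
  moreover have "ennreal c > 0"
    using c(1) by simp
  ultimately show "limsup (\<lambda>n. ennreal (X n)) > 0"
    unfolding not_le[symmetric] Limsup_le_iff by blast
qed

text \<open>Markov's inequality gives the forward direction. Backwards, \<open>F\<close> is at most
  \<open>d\<close> on \<open>A\<close> and at most 1 elsewhere, so mass on \<open>A\<close> pulls
  the mean below 1 by a fixed amount.\<close>

lemma liminf_expectation_less_one_iff:
  fixes F :: "'a \<Rightarrow> real"
  assumes F: "\<And>x. 0 \<le> F x" "\<And>x. F x \<le> 1"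
  shows "liminf (\<lambda>n. ennreal (measure_pmf.expectation (lam n) F)) < 1 \<longleftrightarrow>
    (\<exists>A. supL lam A > 0 \<and> (\<exists>d<1. \<forall>x\<in>A. F x \<le> d))"
proof -
  have nonneg: "0 \<le> measure_pmf.expectation (lam n) F" for n
    by (rule expectation_pmf_unit_interval) (use F in auto)
  have "(\<exists>c<1. \<exists>\<^sub>F n in sequentially. measure_pmf.expectation (lam n) F \<le> c) \<longleftrightarrow>
    (\<exists>A. supL lam A > 0 \<and> (\<exists>d<1. \<forall>x\<in>A. F x \<le> d))" (is "?L \<longleftrightarrow> ?R")
  proof
    assume ?L
    then obtain c where c: "c < 1" "\<exists>\<^sub>F n in sequentially. measure_pmf.expectation (lam n) F \<le> c"
      by blast
    have "c \<ge> 0"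
      using frequently_ex[OF c(2)] nonneg order_trans by blast
    \<comment> \<open>Any level strictly between \<open>c\<close> and 1 serves: \<open>c < d\<close>
      makes the Markov bound \<open>1 - c / d\<close> positive, and \<open>d < 1\<close> is part of
      the claim.\<close>
    define d where "d = (1 + c) / 2"
    have d: "c < d" "0 < d" "d < 1"
      using c(1) \<open>c \<ge> 0\<close> by (auto simp: d_def)
    define A where "A = {x. F x \<le> d}"
    have "1 - c / d \<le> measure (lam n) A" if "measure_pmf.expectation (lam n) F \<le> c" for n
    proof -
      have "d * measure (lam n) (- A) = measure_pmf.expectation (lam n) (\<lambda>x. d * indicator (- A) x)"
        by simp
      also have "\<dots> \<le> measure_pmf.expectation (lam n) F"
        by (rule expectation_pmf_mono[where C = 1])
          (use F d in \<open>auto simp: A_def indicator_def\<close>)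
      finally have "measure (lam n) (- A) \<le> c / d"
        using that d by (simp add: field_simps)
      moreover have "measure (lam n) (- A) = 1 - measure (lam n) A"
        using measure_pmf.prob_compl[of A "lam n"] by (simp add: Compl_eq_Diff_UNIV)
      ultimately show ?thesis
        by linarith
    qed
    with c(2) have "\<exists>\<^sub>F n in sequentially. 1 - c / d \<le> measure (lam n) A"
      by (auto elim: frequently_elim1)
    moreover have "1 - c / d > 0"
      using d by simp
    ultimately have "supL lam A > 0"
      unfolding supL_def measure_pmf.emeasure_eq_measure limsup_positive_iff by blast
    with d show ?R
      unfolding A_def by blast
  next
    assume ?R
    then obtain A d where A: "supL lam A > 0" and d: "d < 1" "\<And>x. x \<in> A \<Longrightarrow> F x \<le> d"
      by blast
    then obtain c where c: "c > 0" "\<exists>\<^sub>F n in sequentially. c \<le> measure (lam n) A"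
      unfolding supL_def measure_pmf.emeasure_eq_measure limsup_positive_iff by blast
    have "measure_pmf.expectation (lam n) F \<le> 1 - (1 - d) * c" if "c \<le> measure (lam n) A" for n
    proof -
      have ind: "integrable (measure_pmf (lam n)) (indicator A :: 'a \<Rightarrow> real)"
        by (rule integrable_measure_pmf_bounded[where C = 1]) (simp add: indicator_def)
      have "measure_pmf.expectation (lam n) F
          \<le> measure_pmf.expectation (lam n) (\<lambda>x. 1 - (1 - d) * indicator A x)"
        by (rule expectation_pmf_mono[where C = 1])
          (use F d in \<open>auto simp: indicator_def\<close>)
      also have "\<dots> = 1 - (1 - d) * measure (lam n) A"
        using ind by simp
      also have "\<dots> \<le> 1 - (1 - d) * c"
        using that d by (simp add: mult_left_mono)
      finally show ?thesis .
    qed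
    with c(2) have "\<exists>\<^sub>F n in sequentially. measure_pmf.expectation (lam n) F \<le> 1 - (1 - d) * c"
      by (auto elim: frequently_elim1)
    moreover have "1 - (1 - d) * c < 1"
      using c d by simp
    ultimately show ?L
      by blast
  qed
  then show ?thesis
    by (simp add: liminf_less_one_iff[OF nonneg])
qed

section \<open>Hitting probabilities\<close>

lemma exists_finite_exhaustion:
  assumes "countable (UNIV :: 'a set)"
  obtains B :: "nat \<Rightarrow> 'a set" where "\<And>n. finite (B n)" "incseq B" "(\<Union>n. B n) = UNIV"
proof
  define B where "B n = to_nat_on (UNIV :: 'a set) -` {..n}" for n
  show "finite (B n)" for n
    unfolding B_def using inj_on_to_nat_on[OF assms] by (intro finite_vimageI) auto
  show "incseq B" "(\<Union>n. B n) = UNIV"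
    by (auto simp: B_def incseq_def)
qed

text \<open>Time 0 counts here, so a walk started at the target hits it at once;
  \<open>first_return\<close> ignores the starting point.\<close>

definition hit_at :: "('a \<Rightarrow> 'a pmf) \<Rightarrow> 'a \<Rightarrow> nat \<Rightarrow> 'a \<Rightarrow> ennreal" where
  "hit_at K x n y = emeasure (trajectory K y n) {w. w ! n = x \<and> (\<forall>k<n. w ! k \<noteq> x)}"

lemma hit_at_0: "hit_at K x 0 y = (if y = x then 1 else 0)"
  by (simp add: hit_at_def)

lemma hit_at_Suc:
  "hit_at K x (Suc n) y = (if y = x then 0 else \<integral>\<^sup>+z. hit_at K x n z \<partial>K y)"
proof -
  have "Cons y -` {w. w ! Suc n = x \<and> (\<forall>k<Suc n. w ! k \<noteq> x)} =
    (if y = x then {} else {w. w ! n = x \<and> (\<forall>k<n. w ! k \<noteq> x)})"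
    by (auto simp: All_less_Suc2)
  then show ?thesis
    by (simp add: hit_at_def del: All_less_Suc2)
qed

text \<open>Once the unconstrained time 0 is removed, times 1, 2, ... become 0, 1, ..., and a return
  turns into a first hit from the position after one step.\<close>

lemma first_return_Suc: "first_return K (Suc n) x = (\<integral>\<^sup>+z. hit_at K x n z \<partial>K x)"
proof -
  have "{1..<Suc n} = Suc ` {..<n}"
    by (auto simp: image_iff Suc_le_eq gr0_conv_Suc)
  then have "Cons x -` {w. w ! Suc n = x \<and> (\<forall>k\<in>{1..<Suc n}. w ! k \<noteq> x)} =
    {w. w ! n = x \<and> (\<forall>k<n. w ! k \<noteq> x)}"
    by auto
  then show ?thesis
    by (simp add: first_return_def hit_at_def)
qed

definition hit_prob :: "('a \<Rightarrow> 'a pmf) \<Rightarrow> 'a \<Rightarrow> 'a \<Rightarrow> ennreal" where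
  "hit_prob K x y = (\<Sum>n. hit_at K x n y)"

text \<open>First-step analysis: the hitting probability is harmonic off \<open>x\<close>. Monotone
  convergence moves the series through the integral.\<close>

lemma hit_prob_rec:
  "hit_prob K x y = (if y = x then 1 else \<integral>\<^sup>+z. hit_prob K x z \<partial>K y)"
proof -
  have "hit_prob K x y = hit_at K x 0 y + (\<Sum>n. hit_at K x (Suc n) y)"
    using suminf_offset[of "\<lambda>n. hit_at K x n y" 1] by (simp add: hit_prob_def add.commute)
  then show ?thesis
    by (simp add: hit_at_0 hit_at_Suc hit_prob_def nn_integral_suminf)
qed

text \<open>With h the hitting probability this reads F(x,x) = Ph(x), so 1 - F(x,x) is the failure
  of h to be harmonic at \<open>x\<close>.\<close>

lemma return_prob_eq: "return_prob K x = (\<integral>\<^sup>+z. hit_prob K x z \<partial>K x)"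
proof -
  have "bij_betw Suc UNIV {1..}"
    by (auto simp: bij_betw_def image_iff Suc_le_eq gr0_conv_Suc)
  then have "return_prob K x = (\<Sum>\<^sub>\<infinity>n. first_return K (Suc n) x)"
    unfolding return_prob_def by (rule infsum_reindex_bij_betw[symmetric])
  also have "\<dots> = (\<Sum>n. first_return K (Suc n) x)"
    by (simp add: nn_integral_count_space_nat flip: nn_integral_count_space_eq_infsum)
  finally show ?thesis
    by (simp add: first_return_Suc hit_prob_def nn_integral_suminf)
qed

section \<open>Truncated hitting probabilities and their limit\<close>

text \<open>
  The walk is killed outside \<open>B n\<close> when \<open>n + 1\<close> steps remain. Letting the set vary with the
  number of steps gives a single sequence, in place of a double limit over sets and times.
\<close>

primrec trunc_hit :: "('a \<Rightarrow> 'a pmf) \<Rightarrow> (nat \<Rightarrow> 'a set) \<Rightarrow> 'a \<Rightarrow> nat \<Rightarrow> 'a \<Rightarrow> real" where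
  "trunc_hit K B x 0 y = of_bool (y = x)"
| "trunc_hit K B x (Suc n) y =
    (if y = x then 1 else if y \<in> B n then measure_pmf.expectation (K y) (trunc_hit K B x n) else 0)"

lemma trunc_hit_self [simp]: "trunc_hit K B x n x = 1"
  by (cases n) auto

lemma trunc_hit_nonneg: "0 \<le> trunc_hit K B x n y"
  and trunc_hit_le_1: "trunc_hit K B x n y \<le> 1"
  by (induction n arbitrary: y) (auto intro: expectation_pmf_unit_interval)

text \<open>This makes the truncations admissible test functions for the capacity.\<close>

lemma finite_support_trunc_hit:
  assumes "\<And>n. finite (B n)"
  shows "finite {y. trunc_hit K B x n y \<noteq> 0}"
proof (rule finite_subset)
  show "{y. trunc_hit K B x n y \<noteq> 0} \<subseteq> insert x (\<Union>k<n. B k)"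
    by (cases n) auto
qed (use assms in auto)

text \<open>Passing to \<open>Suc n\<close> both allows one more step and enlarges the set in which
  the walk survives; each can only increase the value.\<close>

lemma trunc_hit_mono_Suc:
  assumes "incseq B"
  shows "trunc_hit K B x n y \<le> trunc_hit K B x (Suc n) y"
proof (induction n arbitrary: y)
  case 0
  then show ?case
    by (auto intro: expectation_pmf_unit_interval)
next
  case (Suc n)
  have "B n \<subseteq> B (Suc n)"
    using assms by (simp add: incseq_SucD)
  moreover have "measure_pmf.expectation (K y) (trunc_hit K B x n)
      \<le> measure_pmf.expectation (K y) (trunc_hit K B x (Suc n))"
    by (rule expectation_pmf_mono[OF trunc_hit_nonneg Suc.IH trunc_hit_le_1])
  moreover have "0 \<le> measure_pmf.expectation (K y) (trunc_hit K B x (Suc n))"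
    by (rule expectation_pmf_unit_interval[OF trunc_hit_nonneg trunc_hit_le_1])
  ultimately show ?case
    \<comment> \<open>Only the outermost step is unfolded, so that the averages keep the form of the
      facts above.\<close>
    unfolding trunc_hit.simps(2)[of K B x n y] trunc_hit.simps(2)[of K B x "Suc n" y] by auto
qed

text \<open>Off \<open>x\<close> the value is either 0 or the average of the preceding truncation,
  which is at most the average of the present one by monotonicity.\<close>

lemma trunc_hit_subharmonic:
  assumes "incseq B" "y \<noteq> x"
  shows "trunc_hit K B x n y \<le> measure_pmf.expectation (K y) (trunc_hit K B x n)"
proof (cases n)
  case 0
  then show ?thesis
    using assms(2) by (auto intro: expectation_pmf_unit_interval)
next
  case (Suc k)
  have "measure_pmf.expectation (K y) (trunc_hit K B x k)
      \<le> measure_pmf.expectation (K y) (trunc_hit K B x n)"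
    unfolding Suc
    by (rule expectation_pmf_mono[OF trunc_hit_nonneg trunc_hit_mono_Suc[OF assms(1)] trunc_hit_le_1])
  moreover have "0 \<le> measure_pmf.expectation (K y) (trunc_hit K B x n)"
    by (rule expectation_pmf_unit_interval[OF trunc_hit_nonneg trunc_hit_le_1])
  ultimately show ?thesis
    using assms(2) by (simp add: Suc)
qed

text \<open>The limit \<open>h\<close> is squeezed onto \<open>hit_prob\<close>: each truncation is
  at most \<open>hit_prob\<close> by induction, and each partial sum of the hitting series is at
  most \<open>h\<close>, because \<open>h\<close> solves the first-step equation.\<close>

lemma trunc_hit_tendsto:
  assumes "incseq B" "(\<Union>n. B n) = UNIV"
  obtains h where "\<And>y. (\<lambda>n. trunc_hit K B x n y) \<longlonglongrightarrow> h y"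
    "\<And>y. hit_prob K x y = ennreal (h y)" "\<And>y. 0 \<le> h y" "\<And>y. h y \<le> 1" "h x = 1"
    "\<And>y. y \<noteq> x \<Longrightarrow> h y = measure_pmf.expectation (K y) h"
    "\<And>y. (\<lambda>n. measure_pmf.expectation (K y) (trunc_hit K B x n))
      \<longlonglongrightarrow> measure_pmf.expectation (K y) h"
proof -
  define f where "f = trunc_hit K B x"
  define h where "h y = lim (\<lambda>n. f n y)" for y
  have f01: "0 \<le> f n y" "f n y \<le> 1" for n y
    by (simp_all add: f_def trunc_hit_nonneg trunc_hit_le_1)
  have inc: "incseq (\<lambda>n. f n y)" for y
    using trunc_hit_mono_Suc[OF assms(1)] by (auto simp: f_def intro: incseq_SucI simp del: trunc_hit.simps)
  have lim: "(\<lambda>n. f n y) \<longlonglongrightarrow> h y" for y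
    using incseq_convergent[OF inc, of y 1] f01 unfolding h_def
    by (metis convergentI convergent_LIMSEQ_iff)
  have le_h: "f n y \<le> h y" for n y
    by (rule incseq_le[OF inc lim])
  have h01: "0 \<le> h y" "h y \<le> 1" for y
    using LIMSEQ_le_const[OF lim] LIMSEQ_le_const2[OF lim] f01 by blast+
  have lim_E: "(\<lambda>n. measure_pmf.expectation (K y) (f n)) \<longlonglongrightarrow> measure_pmf.expectation (K y) h" for y
    by (rule integral_dominated_convergence[where w = "\<lambda>_. 1"]) (use lim f01 in auto)
  have "h x = 1"
    using LIMSEQ_unique[OF lim[of x], of 1] by (simp add: f_def)
  have harm: "h y = measure_pmf.expectation (K y) h" if "y \<noteq> x" for y
  proof -
    obtain N where "y \<in> B N"
      using assms(2) by blast
    then have "y \<in> B n" if "n \<ge> N" for n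
      using assms(1) that by (auto simp: incseq_def)
    \<comment> \<open>Killing eventually no longer affects the first step from \<open>y\<close>, so
      the recursion passes to the limit.\<close>
    then have "\<forall>\<^sub>F n in sequentially. measure_pmf.expectation (K y) (f n) = f (Suc n) y"
      using that by (auto simp: f_def eventually_sequentially)
    with lim_E have "(\<lambda>n. f (Suc n) y) \<longlonglongrightarrow> measure_pmf.expectation (K y) h"
      by (rule Lim_transform_eventually)
    then show ?thesis
      using LIMSEQ_unique LIMSEQ_Suc[OF lim] by blast
  qed
  have "ennreal (f n y) \<le> hit_prob K x y" for n y
  proof (induction n arbitrary: y)
    case 0
    then show ?case
      by (simp add: f_def hit_prob_rec[of K x y])
  next
    case (Suc n)
    have "ennreal (measure_pmf.expectation (K y) (f n)) \<le> (\<integral>\<^sup>+z. hit_prob K x z \<partial>K y)"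
      using f01 Suc.IH by (subst nn_integral_pmf_eq_expectation[symmetric]) (auto intro: nn_integral_mono)
    then show ?case
      by (simp add: f_def hit_prob_rec[of K x y])
  qed
  then have "ennreal (h y) \<le> hit_prob K x y" for y
    using LIMSEQ_le_const2[OF tendsto_ennrealI[OF lim]] by blast
  \<comment> \<open>This is the minimality of the hitting probability among nonnegative solutions of
    the first-step equation.\<close>
  moreover have "(\<Sum>k<n. hit_at K x k y) \<le> ennreal (h y)" for n y
  proof (induction n arbitrary: y)
    case (Suc n)
    have "(\<Sum>k<Suc n. hit_at K x k y) = hit_at K x 0 y + (\<Sum>k<n. hit_at K x (Suc k) y)"
      by (rule sum.lessThan_Suc_shift)
    also have "\<dots> = (if y = x then 1 else \<integral>\<^sup>+z. (\<Sum>k<n. hit_at K x k z) \<partial>K y)"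
      by (simp add: hit_at_0 hit_at_Suc nn_integral_sum)
    also have "\<dots> \<le> (if y = x then 1 else \<integral>\<^sup>+z. ennreal (h z) \<partial>K y)"
      using Suc.IH by (auto intro: nn_integral_mono)
    also have "\<dots> = ennreal (h y)"
      using harm[of y] \<open>h x = 1\<close> nn_integral_pmf_eq_expectation[of h 1 "K y", OF h01] by auto
    finally show ?case .
  qed simp
  then have "hit_prob K x y \<le> ennreal (h y)" for y
    unfolding hit_prob_def by (intro suminf_le_const) auto
  ultimately show thesis
    using lim h01 \<open>h x = 1\<close> harm lim_E unfolding f_def by (intro that[of h]) (auto intro: antisym)
qed

section \<open>The Dirichlet form of the network\<close>

text \<open>Energies are extended nonnegative sums, while the estimates are made for real sums over
  finite edge sets; a bound uniform in the finite set carries over.\<close>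

lemma infsum_ennreal_leI:
  fixes g :: "'a \<Rightarrow> real"
  assumes "\<And>F. finite F \<Longrightarrow> F \<subseteq> A \<Longrightarrow> sum g F \<le> s" "\<And>a. a \<in> A \<Longrightarrow> 0 \<le> g a"
  shows "(\<Sum>\<^sub>\<infinity>a\<in>A. ennreal (g a)) \<le> ennreal s"
proof (rule infsum_le_finite_sums)
  fix F assume F: "finite F" "F \<subseteq> A"
  then have "(\<Sum>a\<in>F. ennreal (g a)) = ennreal (sum g F)"
    using assms(2) by (intro sum_ennreal) auto
  with assms(1)[OF F] show "(\<Sum>a\<in>F. ennreal (g a)) \<le> ennreal s"
    by (simp add: ennreal_leI)
qed (simp add: nonneg_summable_on_complete)

lemma sum_le_infsum_ennreal:
  fixes g :: "'a \<Rightarrow> real"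
  assumes "(\<Sum>\<^sub>\<infinity>a\<in>A. ennreal (g a)) \<le> ennreal s" "0 \<le> s" "\<And>a. a \<in> A \<Longrightarrow> 0 \<le> g a"
    and F: "finite F" "F \<subseteq> A"
  shows "sum g F \<le> s"
proof -
  have "ennreal (sum g F) = (\<Sum>a\<in>F. ennreal (g a))"
    using assms by (intro sum_ennreal[symmetric]) auto
  also have "\<dots> \<le> (\<Sum>\<^sub>\<infinity>a\<in>A. ennreal (g a))"
    unfolding nonneg_infsum_complete[of A "\<lambda>a. ennreal (g a)", simplified]
    using F by (intro SUP_upper) auto
  also note assms(1)
  finally show ?thesis
    using assms(2) by (simp add: ennreal_le_iff)
qed

section \<open>Conductances and sums over oriented edges\<close>

locale reversible_network =
  fixes K :: "'a \<Rightarrow> 'a pmf" and m :: "'a \<Rightarrow> real" and src tgt :: "'a set \<Rightarrow> 'a"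
  assumes rev: "reversible K m" and ori: "orientation K src tgt"
begin

text \<open>The conductance, extended by 0 to pairs that are not edges, so that edge sums can be
  taken over all ordered pairs.\<close>

definition cond :: "'a \<Rightarrow> 'a \<Rightarrow> real" where
  "cond y z = m y * pmf (K y) z"

abbreviation avg :: "('a \<Rightarrow> real) \<Rightarrow> 'a \<Rightarrow> real" where
  "avg f y \<equiv> measure_pmf.expectation (K y) f"

lemma m_pos: "0 < m y"
  using rev by (simp add: reversible_def)

lemma cond_commute: "cond y z = cond z y"
  using rev by (simp add: reversible_def cond_def)

lemma cond_nonneg: "0 \<le> cond y z"
  using m_pos[of y] by (simp add: cond_def)

lemma cond_pos_iff: "0 < cond y z \<longleftrightarrow> 0 < pmf (K y) z"
  using m_pos[of y] by (simp add: cond_def zero_less_mult_iff)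

lemma cond_eq_0_iff: "cond y z = 0 \<longleftrightarrow> \<not> 0 < cond y z"
  using cond_nonneg[of y z] by auto

lemma edge_iff: "e \<in> edges K \<longleftrightarrow> e = {src e, tgt e} \<and> 0 < cond (src e) (tgt e)"
proof
  assume e: "e \<in> edges K"
  then obtain y z where yz: "e = {y, z}" "0 < cond y z"
    by (auto simp: edges_def cond_pos_iff)
  have "e = {src e, tgt e}"
    using e ori by (auto simp: orientation_def)
  with yz show "e = {src e, tgt e} \<and> 0 < cond (src e) (tgt e)"
    by (metis cond_commute doubleton_eq_iff)
next
  assume "e = {src e, tgt e} \<and> 0 < cond (src e) (tgt e)"
  then show "e \<in> edges K"
    unfolding edges_def cond_pos_iff by blast
qed

lemma edge_pairI:
  assumes "0 < cond y z"
  shows "{y, z} \<in> edges K" "{src {y, z}, tgt {y, z}} = {y, z}"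
proof -
  show *: "{y, z} \<in> edges K"
    using assms by (auto simp: edges_def cond_pos_iff)
  show "{src {y, z}, tgt {y, z}} = {y, z}"
    using * edge_iff[of "{y, z}"] by simp
qed

lemma resistance_eq: "resistance K m src tgt e = inverse (cond (src e) (tgt e))"
  by (simp add: resistance_def cond_def)

lemma has_sum_cond:
  assumes "\<And>z. \<bar>f z\<bar> \<le> C"
  shows "((\<lambda>z. cond y z * f z) has_sum m y * avg f y) UNIV"
  using has_sum_cmult_right[OF has_sum_expectation[of f C "K y", OF assms], of "m y"]
  by (simp add: cond_def mult.assoc)

text \<open>Every edge yields its two ordered pairs, and every pair of positive conductance arises
  so. Only loops yield the same pair twice, and there \<open>\<phi>\<close> vanishes.\<close>

lemma has_sum_edges:
  fixes \<phi> :: "'a \<times> 'a \<Rightarrow> real"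
  assumes summable: "\<phi> summable_on UNIV"
    and diag: "\<And>y. \<phi> (y, y) = 0" and null: "\<And>y z. cond y z = 0 \<Longrightarrow> \<phi> (y, z) = 0"
  shows "((\<lambda>e. \<phi> (src e, tgt e) + \<phi> (tgt e, src e)) has_sum infsum \<phi> UNIV) (edges K)"
proof -
  define s s' where "s e = (src e, tgt e)" and "s' e = (tgt e, src e)" for e
  define S S' where "S = s ` edges K" and "S' = s' ` edges K"
  have inj: "inj_on s (edges K)" "inj_on s' (edges K)"
    by (auto simp: inj_on_def s_def s'_def edge_iff)
  have sub: "\<phi> summable_on X" for X
    by (rule summable_on_subset_banach[OF summable]) simp
  have "(y, z) \<in> S \<union> S'" if "0 < cond y z" for y z
  proof -
    have "s {y, z} = (y, z) \<or> s' {y, z} = (y, z)"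
      using edge_pairI(2)[OF that] by (auto simp: s_def s'_def doubleton_eq_iff)
    then show ?thesis
      using edge_pairI(1)[OF that] by (auto simp: S_def S'_def image_iff) metis+
  qed
  then have null': "\<phi> p = 0" if "p \<notin> S \<union> S'" for p
    using that null by (metis cond_eq_0_iff prod.collapse)
  \<comment> \<open>A pair read off in both directions comes from a single edge equal to its own
    reversal, that is, a loop.\<close>
  have "\<phi> p = 0" if p: "p \<in> S \<inter> S'" for p
  proof -
    obtain e e' where e: "e \<in> edges K" "e' \<in> edges K" "p = (src e, tgt e)" "p = (tgt e', src e')"
      using p unfolding S_def S'_def s_def s'_def by blast
    then have "e = e'"
      by (metis Pair_inject edge_iff insert_commute)
    then have "p = (src e, src e)"
      using e(3,4) by (metis Pair_inject)
    then show ?thesis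
      by (simp add: diag)
  qed
  then have "infsum \<phi> S' = infsum \<phi> (S' - S)"
    by (intro infsum_cong_neutral) auto
  then have "infsum \<phi> S + infsum \<phi> S' = infsum \<phi> (S \<union> (S' - S))"
    by (subst infsum_Un_disjoint[OF sub sub]) auto
  also have "\<dots> = infsum \<phi> UNIV"
    using null' by (intro infsum_cong_neutral) auto
  finally have "infsum \<phi> S + infsum \<phi> S' = infsum \<phi> UNIV" .
  moreover have "((\<phi> \<circ> s) has_sum infsum \<phi> S) (edges K)"
    unfolding S_def by (rule iffD1[OF has_sum_reindex[OF inj(1)] has_sum_infsum[OF sub]])
  moreover have "((\<phi> \<circ> s') has_sum infsum \<phi> S') (edges K)"
    unfolding S'_def by (rule iffD1[OF has_sum_reindex[OF inj(2)] has_sum_infsum[OF sub]])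
  ultimately have "((\<lambda>e. (\<phi> \<circ> s) e + (\<phi> \<circ> s') e) has_sum infsum \<phi> UNIV) (edges K)"
    by (metis has_sum_add)
  then show ?thesis
    by (simp add: s_def s'_def)
qed

text \<open>Edges at \<open>y\<close> are indexed by their other endpoint. Outgoing ones carry
  \<open>\<theta>\<close> and incoming ones \<open>- \<theta>\<close>, so the net outflow is the sum
  of \<open>\<theta>\<close> over all neighbours. Hence the gradient of \<open>h\<close> obeys the
  source-free node law wherever \<open>h\<close> is harmonic.\<close>

lemma gradient_divergence:
  fixes h :: "'a \<Rightarrow> real"
  assumes h: "\<And>z. \<bar>h z\<bar> \<le> C"
  defines "u \<equiv> \<lambda>e. cond (src e) (tgt e) * (h (src e) - h (tgt e))"
  shows "u summable_on {e \<in> edges K. src e = y}" "u summable_on {e \<in> edges K. tgt e = y}"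
    "infsum u {e \<in> edges K. src e = y} - infsum u {e \<in> edges K. tgt e = y} = m y * (h y - avg h y)"
proof -
  define \<theta> where "\<theta> z = cond y z * (h y - h z)" for z
  have bound: "\<bar>h y - h z\<bar> \<le> 2 * C" for z
    using h[of y] h[of z] by linarith
  have "integrable (measure_pmf (K y)) h"
    by (rule integrable_measure_pmf_bounded[OF h])
  then have "avg (\<lambda>z. h y - h z) y = h y - avg h y"
    by simp
  then have \<theta>: "(\<theta> has_sum m y * (h y - avg h y)) UNIV"
    using has_sum_cond[of "\<lambda>z. h y - h z" "2 * C" y, OF bound] by (simp add: \<theta>_def[abs_def])
  \<comment> \<open>A loop at \<open>y\<close> puts \<open>y\<close> into both sets, which is why
    \<open>T - S\<close> replaces \<open>T\<close> below.\<close>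
  define S T where "S = {z. 0 < cond y z \<and> src {y, z} = y}" and "T = {z. 0 < cond y z \<and> tgt {y, z} = y}"
  have sub: "\<theta> summable_on X" for X
    by (rule summable_on_subset_banach[of _ UNIV]) (use \<theta> has_sum_imp_summable in auto)
  have S: "(u has_sum infsum \<theta> S) {e \<in> edges K. src e = y}"
    using has_sum_infsum[OF sub, of S]
  proof (rule iffD2[OF has_sum_reindex_bij_witness[where i = "\<lambda>z. {y, z}" and j = tgt], rotated -1])
    fix z assume z: "z \<in> S"
    then show "tgt {y, z} = z"
      using edge_pairI[of y z] by (auto simp: S_def doubleton_eq_iff)
    show "{y, z} \<in> {e \<in> edges K. src e = y}"
      using z edge_pairI[of y z] by (auto simp: S_def)
  next
    fix e assume e: "e \<in> {e \<in> edges K. src e = y}"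
    then show "{y, tgt e} = e" "tgt e \<in> S"
      by (auto simp: S_def edge_iff)
    show "\<theta> (tgt e) = u e"
      using e by (auto simp: \<theta>_def u_def)
  qed simp
  have T: "((\<lambda>e. - u e) has_sum infsum \<theta> T) {e \<in> edges K. tgt e = y}"
    using has_sum_infsum[OF sub, of T]
  proof (rule iffD2[OF has_sum_reindex_bij_witness[where i = "\<lambda>z. {y, z}" and j = src], rotated -1])
    fix z assume z: "z \<in> T"
    then show "src {y, z} = z"
      using edge_pairI[of y z] by (auto simp: T_def doubleton_eq_iff)
    show "{y, z} \<in> {e \<in> edges K. tgt e = y}"
      using z edge_pairI[of y z] by (auto simp: T_def)
  next
    fix e assume e: "e \<in> {e \<in> edges K. tgt e = y}"
    then show "{y, src e} = e" "src e \<in> T"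
      by (auto simp: T_def edge_iff cond_commute insert_commute)
    show "\<theta> (src e) = - u e"
      using e by (auto simp: \<theta>_def u_def cond_commute[of "src e"] algebra_simps)
  qed simp
  then have T': "(u has_sum - infsum \<theta> T) {e \<in> edges K. tgt e = y}"
    using iffD1[OF has_sum_uminus T] by simp
  have "\<theta> z = 0" if "z \<in> S \<inter> T" for z
  proof -
    have "{y, z} = {y, y}"
      using that edge_pairI(2)[of y z] by (auto simp: S_def T_def)
    then show ?thesis
      by (auto simp: \<theta>_def doubleton_eq_iff)
  qed
  then have "infsum \<theta> T = infsum \<theta> (T - S)"
    by (intro infsum_cong_neutral) auto
  then have "infsum \<theta> S + infsum \<theta> T = infsum \<theta> (S \<union> (T - S))"
    by (subst infsum_Un_disjoint[OF sub sub]) auto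
  also have "\<dots> = infsum \<theta> UNIV"
  proof (rule infsum_cong_neutral)
    fix z assume "z \<in> UNIV - (S \<union> (T - S))"
    then have "\<not> 0 < cond y z"
      using edge_pairI(2)[of y z] by (auto simp: S_def T_def doubleton_eq_iff)
    then show "\<theta> z = 0"
      using cond_eq_0_iff by (simp add: \<theta>_def)
  qed auto
  also have "\<dots> = m y * (h y - avg h y)"
    using \<theta> by (rule infsumI)
  finally show "infsum u {e \<in> edges K. src e = y} - infsum u {e \<in> edges K. tgt e = y} = m y * (h y - avg h y)"
    using infsumI[OF S] infsumI[OF T'] by simp
  show "u summable_on {e \<in> edges K. src e = y}" "u summable_on {e \<in> edges K. tgt e = y}"
    using S T' has_sum_imp_summable by blast+
qed

section \<open>Green's formula and the duality of flows and capacity\<close>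

text \<open>Green's formula: one sum over ordered pairs is evaluated row by row on the right and
  edge by edge on the left. Finite support leaves finitely many absolutely summable rows.\<close>

lemma has_sum_dirichlet_form:
  fixes f :: "'a \<Rightarrow> real"
  assumes fin: "finite {y. f y \<noteq> 0}"
  shows "((\<lambda>e. cond (src e) (tgt e) * (f (tgt e) - f (src e))\<^sup>2) has_sum
    (\<Sum>y | f y \<noteq> 0. m y * f y * (f y - avg f y))) (edges K)"
proof -
  define S where "S = {y. f y \<noteq> 0}"
  have "finite (f ` UNIV)"
    by (rule finite_subset[of _ "insert 0 (f ` S)"]) (use fin in \<open>auto simp: S_def\<close>)
  then obtain C where C: "\<bar>f z\<bar> \<le> C" for z
    using finite_imp_bounded[of "f ` UNIV"] by (auto simp: bounded_iff)
  \<comment> \<open>A one-sided form that vanishes off the rows of the support; adding its value at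
    the reversed pair completes the square.\<close>
  define \<phi> where "\<phi> = (\<lambda>(y, z). cond y z * (f y * (f y - f z)))"
  have bound: "\<bar>f y * (f y - f z)\<bar> \<le> C * (2 * C)" for y z
    unfolding abs_mult using C[of y] C[of z] by (intro mult_mono) auto
  have row: "((\<lambda>z. \<phi> (y, z)) has_sum m y * f y * (f y - avg f y)) UNIV" for y
  proof -
    have "integrable (measure_pmf (K y)) f"
      by (rule integrable_measure_pmf_bounded[OF C])
    then have "avg (\<lambda>z. f y * (f y - f z)) y = f y * (f y - avg f y)"
      by (subst integral_mult_right_zero) simp
    then show ?thesis
      using has_sum_cond[of "\<lambda>z. f y * (f y - f z)" "C * (2 * C)" y, OF bound]
      by (simp only: \<phi>_def mult.assoc prod.case)
  qed
  have "(\<lambda>p. \<bar>\<phi> p\<bar>) summable_on (S \<times> UNIV)"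
  proof (rule summable_on_SigmaI)
    show "((\<lambda>z. \<bar>\<phi> (y, z)\<bar>) has_sum m y * avg (\<lambda>z. \<bar>f y * (f y - f z)\<bar>) y) UNIV" for y
      using has_sum_cond[of "\<lambda>z. \<bar>f y * (f y - f z)\<bar>" "C * (2 * C)" y] bound cond_nonneg
      by (simp add: \<phi>_def abs_mult[of "cond _ _"])
  qed (use fin in \<open>auto simp: S_def\<close>)
  then have "\<phi> summable_on (S \<times> UNIV)"
    using abs_summable_summable[of \<phi>] by simp
  then have "(\<phi> has_sum (\<Sum>y\<in>S. m y * f y * (f y - avg f y))) (S \<times> UNIV)"
    by (rule has_sum_SigmaI[OF row has_sum_finite, rotated]) (use fin in \<open>auto simp: S_def\<close>)
  also have "?this \<longleftrightarrow> (\<phi> has_sum (\<Sum>y\<in>S. m y * f y * (f y - avg f y))) UNIV"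
    by (rule has_sum_cong_neutral) (auto simp: \<phi>_def S_def)
  finally have total: "(\<phi> has_sum (\<Sum>y\<in>S. m y * f y * (f y - avg f y))) UNIV" .
  have "((\<lambda>e. \<phi> (src e, tgt e) + \<phi> (tgt e, src e)) has_sum infsum \<phi> UNIV) (edges K)"
    by (rule has_sum_edges) (use has_sum_imp_summable[OF total] in \<open>auto simp: \<phi>_def\<close>)
  moreover have "\<phi> (src e, tgt e) + \<phi> (tgt e, src e)
      = cond (src e) (tgt e) * (f (tgt e) - f (src e))\<^sup>2" for e
    by (simp add: \<phi>_def cond_commute[of "tgt e"] power2_eq_square algebra_simps)
  ultimately show ?thesis
    using infsumI[OF total] by (simp add: S_def)
qed

text \<open>Summation by parts pairs the flow with a test function \<open>f\<close>: the node law
  leaves only \<open>i0 * f x\<close>, which is \<open>i0\<close>. Cauchy-Schwarz bounds its square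
  by the product of the two energies.\<close>

lemma capacity_ge:
  assumes flow: "flow_to_infinity K src tgt x i0 u"
    and energy: "energy K m src tgt u \<le> ennreal C" and "0 < C"
  shows "ennreal (i0\<^sup>2 / C) \<le> capacity K m src tgt x"
  unfolding capacity_def
proof (rule INF_greatest, clarify)
  fix f :: "'a \<Rightarrow> real"
  assume fin: "finite {y. f y \<noteq> 0}" and fx: "f x = 1"
  define r where "r = resistance K m src tgt"
  define D where "D = (\<Sum>\<^sub>\<infinity>e\<in>edges K. ennreal ((f (tgt e) - f (src e))\<^sup>2 / r e))"
  have r: "0 < r e" if "e \<in> edges K" for e
    using that by (simp add: r_def resistance_eq edge_iff)
  \<comment> \<open>The edges are grouped by their endpoint \<open>g e\<close>, with
    \<open>g\<close> later \<open>src\<close> or \<open>tgt\<close>; only the finitely many groups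
    over the support of \<open>f\<close> contribute.\<close>
  have nodewise: "((\<lambda>e. f (g e) * u e) has_sum (\<Sum>y | f y \<noteq> 0. f y * infsum u {e \<in> edges K. g e = y})) (edges K)"
    if "\<And>y. u summable_on {e \<in> edges K. g e = y}" for g
  proof -
    have part: "((\<lambda>e. f (g e) * u e) has_sum (\<Sum>y\<in>S. f y * infsum u {e \<in> edges K. g e = y})) {e \<in> edges K. g e \<in> S}"
      if "finite S" for S
      using that
    proof induction
      case (insert y S)
      have "((\<lambda>e. f y * u e) has_sum (f y * infsum u {e \<in> edges K. g e = y})) {e \<in> edges K. g e = y}"
        by (intro has_sum_cmult_right has_sum_infsum \<open>\<And>y. u summable_on {e \<in> edges K. g e = y}\<close>)
      then have "((\<lambda>e. f (g e) * u e) has_sum (f y * infsum u {e \<in> edges K. g e = y})) {e \<in> edges K. g e = y}"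
        by (rule has_sum_cong[THEN iffD1, rotated]) auto
      from has_sum_Un_disjoint[OF this insert.IH] insert.hyps
      have "((\<lambda>e. f (g e) * u e) has_sum (\<Sum>y\<in>insert y S. f y * infsum u {e \<in> edges K. g e = y}))
          ({e \<in> edges K. g e = y} \<union> {e \<in> edges K. g e \<in> S})"
        by auto
      also have "{e \<in> edges K. g e = y} \<union> {e \<in> edges K. g e \<in> S} = {e \<in> edges K. g e \<in> insert y S}"
        by auto
      finally show ?case .
    qed simp
    show ?thesis
      by (rule has_sum_cong_neutral[THEN iffD1, OF _ _ _ part[OF fin]]) auto
  qed
  have law: "u summable_on {e \<in> edges K. src e = y}" "u summable_on {e \<in> edges K. tgt e = y}"
    "infsum u {e \<in> edges K. src e = y} = infsum u {e \<in> edges K. tgt e = y} + i0 * (if y = x then 1 else 0)" for y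
    using flow by (auto simp: flow_to_infinity_def)
  have "((\<lambda>e. - (f (tgt e) * u e)) has_sum
      - (\<Sum>y | f y \<noteq> 0. f y * infsum u {e \<in> edges K. tgt e = y})) (edges K)"
    unfolding has_sum_uminus minus_minus by (intro nodewise law)
  from has_sum_add[OF nodewise[of src, OF law(1)] this]
  have "((\<lambda>e. f (src e) * u e - f (tgt e) * u e) has_sum
      ((\<Sum>y | f y \<noteq> 0. f y * infsum u {e \<in> edges K. src e = y}) -
       (\<Sum>y | f y \<noteq> 0. f y * infsum u {e \<in> edges K. tgt e = y}))) (edges K)"
    by simp
  also have "(\<Sum>y | f y \<noteq> 0. f y * infsum u {e \<in> edges K. src e = y}) -
       (\<Sum>y | f y \<noteq> 0. f y * infsum u {e \<in> edges K. tgt e = y}) =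
      (\<Sum>y | f y \<noteq> 0. if y = x then i0 * f y else 0)"
    by (simp add: law(3) flip: sum_subtractf) (rule sum.cong, auto simp: algebra_simps)
  also have "\<dots> = i0"
    using fin fx by simp
  finally have sum_i0: "((\<lambda>e. f (src e) * u e - f (tgt e) * u e) has_sum i0) (edges K)" .
  show "ennreal (i0\<^sup>2 / C) \<le> (\<Sum>\<^sub>\<infinity>e\<in>edges K. ennreal ((f (tgt e) - f (src e))\<^sup>2 / resistance K m src tgt e))"
  proof (cases D)
    case top
    then show ?thesis
      by (simp add: D_def r_def)
  next
    case (real d)
    have "(\<Sum>e\<in>F. f (src e) * u e - f (tgt e) * u e)\<^sup>2 \<le> C * d" if F: "finite F" "F \<subseteq> edges K" for F
    proof -
      \<comment> \<open>The factor \<open>sqrt (r e)\<close> is split off so that the squares of the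
        two factors are exactly the energy terms.\<close>
      have "(\<Sum>e\<in>F. f (src e) * u e - f (tgt e) * u e)
          = (\<Sum>e\<in>F. (u e * sqrt (r e)) * ((f (src e) - f (tgt e)) / sqrt (r e)))"
      proof (rule sum.cong)
        fix e assume "e \<in> F"
        then have "sqrt (r e) \<noteq> 0"
          using F r by fastforce
        then show "f (src e) * u e - f (tgt e) * u e = (u e * sqrt (r e)) * ((f (src e) - f (tgt e)) / sqrt (r e))"
          by (simp add: mult.commute[of _ "u e"] flip: right_diff_distrib)
      qed simp
      then have "(\<Sum>e\<in>F. f (src e) * u e - f (tgt e) * u e)\<^sup>2
          \<le> (\<Sum>e\<in>F. (u e * sqrt (r e))\<^sup>2) * (\<Sum>e\<in>F. ((f (src e) - f (tgt e)) / sqrt (r e))\<^sup>2)"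
        by (simp only: Cauchy_Schwarz_ineq_sum)
      also have "(\<Sum>e\<in>F. (u e * sqrt (r e))\<^sup>2) = (\<Sum>e\<in>F. (u e)\<^sup>2 * r e)"
        using F r by (intro sum.cong) (auto simp: power_mult_distrib less_imp_le dest!: subsetD)
      also have "(\<Sum>e\<in>F. ((f (src e) - f (tgt e)) / sqrt (r e))\<^sup>2) = (\<Sum>e\<in>F. (f (tgt e) - f (src e))\<^sup>2 / r e)"
        using F r by (intro sum.cong) (auto simp: power_divide power2_commute less_imp_le dest!: subsetD)
      also have "(\<Sum>e\<in>F. (u e)\<^sup>2 * r e) * (\<Sum>e\<in>F. (f (tgt e) - f (src e))\<^sup>2 / r e) \<le> C * d"
      proof (rule mult_mono)
        show "(\<Sum>e\<in>F. (u e)\<^sup>2 * r e) \<le> C"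
          using energy F r \<open>0 < C\<close>
          by (intro sum_le_infsum_ennreal[where A = "edges K"]) (auto simp: energy_def r_def less_imp_le)
        show "(\<Sum>e\<in>F. (f (tgt e) - f (src e))\<^sup>2 / r e) \<le> d"
          using real F r
          by (intro sum_le_infsum_ennreal[where A = "edges K"]) (auto simp: D_def less_imp_le)
        show "0 \<le> (\<Sum>e\<in>F. (f (tgt e) - f (src e))\<^sup>2 / r e)"
          using F r by (intro sum_nonneg) (auto simp: less_imp_le dest!: subsetD)
      qed (use \<open>0 < C\<close> in simp)
      finally show ?thesis .
    qed
    \<comment> \<open>The bound does not depend on \<open>F\<close>, so it survives the limit over
      finite edge sets.\<close>
    then have "i0\<^sup>2 \<le> C * d"
      by (intro tendsto_upperbound[OF tendsto_power[OF sum_i0[unfolded has_sum_def]]]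
          eventually_finite_subsets_at_top_weakI) auto
    then have "i0\<^sup>2 / C \<le> d"
      using \<open>0 < C\<close> by (simp add: field_simps)
    then have "ennreal (i0\<^sup>2 / C) \<le> D"
      using real by (simp add: ennreal_leI)
    then show ?thesis
      by (simp add: D_def r_def)
  qed
qed

section \<open>Energy of the hitting probability, capacity and unit flow\<close>

text \<open>In Green's formula the vertex \<open>x\<close> contributes the right-hand side, and
  subharmonicity makes all other contributions nonpositive.\<close>

lemma trunc_hit_dirichlet_le:
  fixes B :: "nat \<Rightarrow> 'a set" and x :: 'a and n :: nat
  assumes "\<And>n. finite (B n)" "incseq B"
  defines "f \<equiv> trunc_hit K B x n"
  assumes F: "finite F" "F \<subseteq> edges K"
  shows "(\<Sum>e\<in>F. cond (src e) (tgt e) * (f (tgt e) - f (src e))\<^sup>2) \<le> m x * (1 - avg f x)"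
proof -
  have fin: "finite {y. f y \<noteq> 0}"
    unfolding f_def by (rule finite_support_trunc_hit[OF assms(1)])
  have "(\<Sum>e\<in>F. cond (src e) (tgt e) * (f (tgt e) - f (src e))\<^sup>2)
      \<le> (\<Sum>y | f y \<noteq> 0. m y * f y * (f y - avg f y))"
    by (rule finite_sum_le_has_sum[OF has_sum_dirichlet_form[OF fin] F]) (simp add: cond_nonneg)
  also have "\<dots> = m x * (1 - avg f x) + (\<Sum>y\<in>{y. f y \<noteq> 0} - {x}. m y * f y * (f y - avg f y))"
    using fin by (subst sum.remove[of _ x]) (auto simp: f_def)
  also have "(\<Sum>y\<in>{y. f y \<noteq> 0} - {x}. m y * f y * (f y - avg f y)) \<le> 0"
  proof (rule sum_nonpos)
    fix y assume "y \<in> {y. f y \<noteq> 0} - {x}"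
    then have "f y \<le> avg f y"
      unfolding f_def by (intro trunc_hit_subharmonic assms) auto
    moreover have "0 \<le> m y * f y"
      using m_pos[of y] by (simp add: f_def trunc_hit_nonneg)
    ultimately show "m y * f y * (f y - avg f y) \<le> 0"
      by (intro mult_nonneg_nonpos) auto
  qed
  finally show ?thesis
    by simp
qed

text \<open>The truncations are test functions for the capacity; their limit supplies, through its
  gradient, a flow from \<open>x\<close> when the walk may fail to return.\<close>

lemma return_prob_capacity_flow:
  assumes count: "countable (UNIV :: 'a set)"
  shows "return_prob K x \<le> 1"
    and "capacity K m src tgt x \<le> ennreal (m x * (1 - enn2real (return_prob K x)))"
    and "return_prob K x < 1 \<Longrightarrow> \<exists>u. flow_to_infinity K src tgt x 1 u \<and>
      energy K m src tgt u \<le> ennreal (1 / (m x * (1 - enn2real (return_prob K x))))"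
proof -
  obtain B :: "nat \<Rightarrow> 'a set" where B: "\<And>n. finite (B n)" "incseq B" "(\<Union>n. B n) = UNIV"
    using exists_finite_exhaustion[OF count] by blast
  obtain h where lim: "\<And>y. (\<lambda>n. trunc_hit K B x n y) \<longlonglongrightarrow> h y"
    and hit: "\<And>y. hit_prob K x y = ennreal (h y)" and h01: "\<And>y. 0 \<le> h y" "\<And>y. h y \<le> 1" and hx: "h x = 1"
    and harm: "\<And>y. y \<noteq> x \<Longrightarrow> h y = avg h y"
    and lim_avg: "\<And>y. (\<lambda>n. avg (trunc_hit K B x n) y) \<longlonglongrightarrow> avg h y"
    using trunc_hit_tendsto[OF B(2,3), of K x] by blast
  have ret: "return_prob K x = ennreal (avg h x)"
    unfolding return_prob_eq hit by (rule nn_integral_pmf_eq_expectation[OF h01])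
  have avg01: "0 \<le> avg h x" "avg h x \<le> 1"
    using expectation_pmf_unit_interval[of h "K x", OF h01] by auto
  then show "return_prob K x \<le> 1"
    using ret by simp
  \<comment> \<open>The net outflow at \<open>x\<close> of the gradient of \<open>h\<close>, and at
    the same time the bound for its energy.\<close>
  define I where "I = m x * (1 - avg h x)"
  have I: "m x * (1 - enn2real (return_prob K x)) = I"
    using ret avg01 by (simp add: I_def)
  have lim_I: "(\<lambda>n. m x * (1 - avg (trunc_hit K B x n) x)) \<longlonglongrightarrow> I"
    unfolding I_def by (intro tendsto_intros lim_avg)
  have "capacity K m src tgt x \<le> ennreal (m x * (1 - avg (trunc_hit K B x n) x))" for n
    unfolding capacity_def
  proof (rule INF_lower2)
    show "trunc_hit K B x n \<in> {f. finite {y. f y \<noteq> 0} \<and> f x = 1}"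
      using finite_support_trunc_hit[OF B(1)] by simp
    show "(\<Sum>\<^sub>\<infinity>e\<in>edges K. ennreal ((trunc_hit K B x n (tgt e) - trunc_hit K B x n (src e))\<^sup>2 / resistance K m src tgt e))
        \<le> ennreal (m x * (1 - avg (trunc_hit K B x n) x))"
      using trunc_hit_dirichlet_le[OF B(1,2)]
      by (intro infsum_ennreal_leI) (auto simp: resistance_eq cond_nonneg mult.commute[of "_\<^sup>2"] divide_inverse)
  qed
  then show "capacity K m src tgt x \<le> ennreal (m x * (1 - enn2real (return_prob K x)))"
    unfolding I using LIMSEQ_le_const[OF tendsto_ennrealI[OF lim_I]] by blast
  assume "return_prob K x < 1"
  then have "0 < I"
    using ret avg01 m_pos[of x] by (simp add: I_def ennreal_less_one_iff)
  define v where "v e = cond (src e) (tgt e) * (h (src e) - h (tgt e))" for e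
  \<comment> \<open>Normalising the input to 1 divides the energy by the square of \<open>I\<close>,
    which turns the bound \<open>I\<close> into \<open>1 / I\<close>.\<close>
  define u where "u e = v e / I" for e
  have div: "v summable_on {e \<in> edges K. src e = y}" "v summable_on {e \<in> edges K. tgt e = y}"
    "infsum v {e \<in> edges K. src e = y} - infsum v {e \<in> edges K. tgt e = y} = m y * (h y - avg h y)" for y
    unfolding v_def by (rule gradient_divergence[where C = 1]; use h01 in simp)+
  have scale: "infsum u X = infsum v X / I" for X
    unfolding u_def[abs_def] divide_inverse by (rule infsum_cmult_left')
  have "flow_to_infinity K src tgt x 1 u"
    unfolding flow_to_infinity_def
  proof (intro allI conjI)
    fix y
    show "u summable_on {e \<in> edges K. src e = y}" "u summable_on {e \<in> edges K. tgt e = y}"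
      unfolding u_def[abs_def] divide_inverse by (intro summable_on_cmult_left div)+
    have "m y * (h y - avg h y) = (if y = x then I else 0)"
      using harm[of y] hx by (simp add: I_def)
    then have "infsum v {e \<in> edges K. src e = y} = infsum v {e \<in> edges K. tgt e = y} + (if y = x then I else 0)"
      using div(3)[of y] by simp
    then show "infsum u {e \<in> edges K. src e = y} = infsum u {e \<in> edges K. tgt e = y} + 1 * (if y = x then 1 else 0)"
      using \<open>0 < I\<close> by (simp add: scale add_divide_distrib)
  qed
  moreover have "energy K m src tgt u \<le> ennreal (1 / I)"
    unfolding energy_def
  proof (rule infsum_ennreal_leI)
    fix F assume F: "finite F" "F \<subseteq> edges K"
    \<comment> \<open>Fatou's argument on a finite edge set: the truncated energies converge
      termwise and their bounds tend to \<open>I\<close>.\<close>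
    have "(\<lambda>n. \<Sum>e\<in>F. cond (src e) (tgt e) * (trunc_hit K B x n (tgt e) - trunc_hit K B x n (src e))\<^sup>2)
        \<longlonglongrightarrow> (\<Sum>e\<in>F. cond (src e) (tgt e) * (h (tgt e) - h (src e))\<^sup>2)"
      by (intro tendsto_intros lim)
    from LIMSEQ_le[OF this lim_I]
    have "(\<Sum>e\<in>F. cond (src e) (tgt e) * (h (tgt e) - h (src e))\<^sup>2) \<le> I"
      using trunc_hit_dirichlet_le[OF B(1,2) F] by blast
    moreover have "(u e)\<^sup>2 * resistance K m src tgt e
        = cond (src e) (tgt e) * (h (tgt e) - h (src e))\<^sup>2 / I\<^sup>2" if "e \<in> F" for e
      using that F \<open>0 < I\<close>
      by (auto simp: u_def v_def resistance_eq edge_iff power2_eq_square field_simps dest!: subsetD)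
    ultimately have "(\<Sum>e\<in>F. (u e)\<^sup>2 * resistance K m src tgt e) \<le> I / I\<^sup>2"
      by (simp add: divide_right_mono flip: sum_divide_distrib)
    then show "(\<Sum>e\<in>F. (u e)\<^sup>2 * resistance K m src tgt e) \<le> 1 / I"
      using \<open>0 < I\<close> by (simp add: power2_eq_square)
  qed (simp add: resistance_eq cond_nonneg)
  ultimately show "\<exists>u. flow_to_infinity K src tgt x 1 u \<and>
      energy K m src tgt u \<le> ennreal (1 / (m x * (1 - enn2real (return_prob K x))))"
    unfolding I by blast
qed

end

section \<open>Equivalence of the three conditions\<close>

text \<open>The sum defining \<open>TOA\<close> is the mean of F(x,x) under \<open>lam n\<close>, so
  the criterion for averages applies.\<close>

lemma TOA_iff:
  assumes "countable (UNIV :: 'a set)" and le_1: "\<And>x. return_prob K x \<le> 1"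
  shows "TOA lam (K :: 'a \<Rightarrow> 'a pmf) \<longleftrightarrow>
    (\<exists>A. supL lam A > 0 \<and> (\<exists>d<1. \<forall>x\<in>A. enn2real (return_prob K x) \<le> d))"
proof -
  define F where "F x = enn2real (return_prob K x)" for x
  have F: "return_prob K x = ennreal (F x)" for x
    using le_1[of x] by (simp add: F_def le_less_trans[of _ 1])
  have F01: "0 \<le> F x" "F x \<le> 1" for x
    using le_1[of x] by (auto simp: F_def enn2real_leI)
  have "(\<Sum>\<^sub>\<infinity>x. return_prob K x * ennreal (pmf (lam n) x)) = ennreal (measure_pmf.expectation (lam n) F)" for n
    unfolding nn_integral_pmf_eq_expectation[OF F01, symmetric] nn_integral_measure_pmf
      nn_integral_count_space_eq_infsum[OF assms(1)] F
    by (simp add: mult.commute)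
  then show ?thesis
    unfolding TOA_def by (simp add: liminf_expectation_less_one_iff[OF F01] flip: F_def)
qed

theorem theorem6p3:
  fixes K :: "'a \<Rightarrow> 'a pmf"
    and lam :: "nat \<Rightarrow> 'a pmf"
    and m :: "'a \<Rightarrow> real"
    and src tgt :: "'a set \<Rightarrow> 'a"
  assumes "infinite (UNIV :: 'a set)" and "countable (UNIV :: 'a set)"
    and "reversible K m"
    and "(INF x. m x) > 0" and "bdd_above (range m)"
    and "orientation K src tgt"
  shows
    "(TOA lam K \<longleftrightarrow>
       (\<exists>A i0 u. supL lam A > 0 \<and> i0 \<noteq> 0 \<and>
          (\<forall>x\<in>A. flow_to_infinity K src tgt x i0 (u x) \<and> energy K m src tgt (u x) < \<infinity>) \<and>
          (SUP x\<in>A. energy K m src tgt (u x)) < \<infinity>)) \<and>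
     (TOA lam K \<longleftrightarrow>
       (\<exists>A. supL lam A > 0 \<and> (INF x\<in>A. capacity K m src tgt x) > 0))"
    (is "(?a \<longleftrightarrow> ?b) \<and> (?a \<longleftrightarrow> ?c)")
proof -
  interpret reversible_network K m src tgt
    using assms by unfold_locales
  note main = return_prob_capacity_flow[OF assms(2)]
  note TOA = TOA_iff[OF assms(2) main(1), of lam]
  define l where "l = (INF x. m x)"
  have "bdd_below (range m)"
    using m_pos by (intro bdd_belowI[of _ 0]) (auto simp: less_imp_le)
  then have l: "0 < l" "l \<le> m x" for x
    using assms(4) by (auto simp: l_def intro: cINF_lower)
  obtain M where M: "m x \<le> M" for x
    using assms(5) by (auto simp: bdd_above_def)
  have "0 < M"
    using m_pos[of undefined] M[of undefined] by linarith
  have ab: ?b if ?a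
  proof -
    obtain A d where A: "supL lam A > 0" and d: "d < 1" "\<And>x. x \<in> A \<Longrightarrow> enn2real (return_prob K x) \<le> d"
      using \<open>?a\<close> TOA by blast
    \<comment> \<open>The lower bound \<open>l\<close> of \<open>m\<close> makes the energy bound
      uniform over \<open>A\<close>, with common input 1.\<close>
    have "\<exists>u. flow_to_infinity K src tgt x 1 u \<and> energy K m src tgt u \<le> ennreal (1 / (l * (1 - d)))"
      if "x \<in> A" for x
    proof -
      have "enn2real (return_prob K x) < 1"
        using d that by force
      then have "return_prob K x < 1"
        using main(1)[of x] by (metis enn2real_1 less_le)
      then obtain u where u: "flow_to_infinity K src tgt x 1 u"
        "energy K m src tgt u \<le> ennreal (1 / (m x * (1 - enn2real (return_prob K x))))"
        using main(3) by blast
      have "l * (1 - d) \<le> m x * (1 - enn2real (return_prob K x))"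
        using l(1) l(2)[of x] d(1) d(2)[OF that] m_pos[of x] by (intro mult_mono) auto
      moreover have "0 < l * (1 - d)"
        using l d by simp
      ultimately have "1 / (m x * (1 - enn2real (return_prob K x))) \<le> 1 / (l * (1 - d))"
        by - (rule frac_le[OF zero_le_one order_refl])
      then show ?thesis
        using u ennreal_leI order_trans by blast
    qed
    then obtain u where u: "\<And>x. x \<in> A \<Longrightarrow> flow_to_infinity K src tgt x 1 (u x)"
      "\<And>x. x \<in> A \<Longrightarrow> energy K m src tgt (u x) \<le> ennreal (1 / (l * (1 - d)))"
      by metis
    have "(SUP x\<in>A. energy K m src tgt (u x)) \<le> ennreal (1 / (l * (1 - d)))"
      using u(2) by (rule SUP_least)
    also have "\<dots> < \<infinity>"
      by simp
    finally have "(SUP x\<in>A. energy K m src tgt (u x)) < \<infinity>" .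
    moreover from this have "energy K m src tgt (u x) < \<infinity>" if "x \<in> A" for x
      using that SUP_upper le_less_trans by metis
    ultimately show ?b
      using A u(1) by (intro exI[of _ A] exI[of _ 1] exI[of _ u]) auto
  qed
  have bc: ?c if ?b
  proof -
    obtain A i0 u where A: "supL lam A > 0" and "i0 \<noteq> 0"
      and flow: "\<And>x. x \<in> A \<Longrightarrow> flow_to_infinity K src tgt x i0 (u x)"
      and bdd: "(SUP x\<in>A. energy K m src tgt (u x)) < \<infinity>"
      using \<open>?b\<close> by blast
    obtain C where C: "(SUP x\<in>A. energy K m src tgt (u x)) = ennreal C" "0 \<le> C"
      using bdd by (cases "SUP x\<in>A. energy K m src tgt (u x)") auto
    \<comment> \<open>Adding 1 provides the positive energy bound required for the division, even if
      \<open>C\<close> is 0.\<close>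
    have "ennreal (i0\<^sup>2 / (C + 1)) \<le> capacity K m src tgt x" if "x \<in> A" for x
    proof (rule capacity_ge[OF flow[OF that]])
      have "energy K m src tgt (u x) \<le> ennreal C"
        using that C(1) by (metis SUP_upper)
      also have "\<dots> \<le> ennreal (C + 1)"
        by (simp add: ennreal_leI)
      finally show "energy K m src tgt (u x) \<le> ennreal (C + 1)" .
    qed (use C in simp)
    then have "ennreal (i0\<^sup>2 / (C + 1)) \<le> (INF x\<in>A. capacity K m src tgt x)"
      by (rule INF_greatest)
    moreover have "0 < ennreal (i0\<^sup>2 / (C + 1))"
      using \<open>i0 \<noteq> 0\<close> C by simp
    ultimately show ?c
      using A by (meson less_le_trans)
  qed
  have ca: ?a if ?c
  proof -
    obtain A where A: "supL lam A > 0" and pos: "0 < (INF x\<in>A. capacity K m src tgt x)"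
      using \<open>?c\<close> by blast
    \<comment> \<open>A real lower bound is extracted; an infinite infimum is covered by
      \<open>t = 1\<close>.\<close>
    obtain t where t: "0 < t" "ennreal t \<le> (INF x\<in>A. capacity K m src tgt x)"
    proof (cases "INF x\<in>A. capacity K m src tgt x")
      case (real r)
      with pos that[of r] show ?thesis
        by simp
    next
      case top
      with that[of 1] show ?thesis
        by simp
    qed
    \<comment> \<open>The capacity is at most \<open>m x * (1 - F(x,x))\<close>, and the upper bound
      \<open>M\<close> of \<open>m\<close> makes the resulting gap below 1 uniform.\<close>
    have "enn2real (return_prob K x) \<le> 1 - t / M" if "x \<in> A" for x
    proof -
      have "ennreal t \<le> capacity K m src tgt x"
        using t(2) that by (meson INF_lower order_trans)
      also note main(2)
      finally have "t \<le> m x * (1 - enn2real (return_prob K x))"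
        using t(1) by (simp add: ennreal_le_iff2)
      also have "\<dots> \<le> M * (1 - enn2real (return_prob K x))"
        using M[of x] main(1)[of x] by (intro mult_right_mono) (auto simp: enn2real_leI)
      finally show ?thesis
        using \<open>0 < M\<close> by (simp add: field_simps)
    qed
    moreover have "1 - t / M < 1"
      using t \<open>0 < M\<close> by simp
    ultimately show ?a
      using A TOA by blast
  qed
  from ab bc ca show ?thesis
    by blast
qed

end
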